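(* The problem (D): minimize over $w\in L^2([0,1];\mathbb{R})$ $$\int_0^1\vartheta(w(t),t)\,dt - \big(x_f^Tp(1)-x_0^Tp(0)\big)$$ subject to $\dot p(t)=-A^T(t)p(t)$, $w(t)=b^T(t)p(t)$ for all $t\in[0,1]$ (with $p\in W^{1,2}([0,1];\mathbb{R}^n)$), where $$\vartheta(w,t)=\begin{cases}\overline a(t)w - r(t)\overline a(t)^2/2, & w>r(t)\overline a(t),\\ w^2/(2r(t)), & r(t)\underline a(t)\le w\le r(t)\overline a(t),\\ \underline a(t)w-r(t)\underline a(t)^2/2, & w<r(t)\underline a(t),\end{cases}$$ is the Fenchel dual of the problem (P): $\min_{u\in L^2([0,1];\mathbb{R})} f(u)+g(u)$. That is, (D) is the problem $\min_{w\in L^2([0,1];\mathbb{R})} f^*(w)+g^*(-w)$: for $w\in L^2([0,1];\mathbb{R})$, if there is $p$ satisfying the constraints of (D) together with $w$, then $f^*(w)+g^*(-w)$ equals the objective value of (D) at $w$ (for any such $p$), and otherwise $f^*(w)+g^*(-w)=+\infty$.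
   Context: Data: $A:[0,1]\to\mathbb{R}^{n\times n}$ and $b:[0,1]\to\mathbb{R}^{n\times 1}$ are continuous, $b$ is not the zero vector, $r:[0,1]\to(0,\infty)$ is continuous, $\underline a,\overline a:[0,1]\to\mathbb{R}$ are continuous with $\underline a(t)<\overline a(t)$ for all $t$, and $x_0,x_f\in\mathbb{R}^n$. $W^{1,2}([0,1];\mathbb{R}^n)$ is the space of absolutely continuous $z\in L^2([0,1];\mathbb{R}^n)$ with $\dot z\in L^2([0,1];\mathbb{R}^n)$. $\mathcal A$ is the set of $u\in L^2([0,1];\mathbb{R})$ for which there exists $x\in W^{1,2}([0,1];\mathbb{R}^n)$ with $\dot x(t) = A(t)x(t)+b(t)u(t)$ for a.e. $t\in[0,1]$, $x(0)=x_0$ and $x(1)=x_f$. $\mathcal B$ is the set of $u\in L^2([0,1];\mathbb{R})$ with $\underline a(t)\le u(t)\le\overline a(t)$ for a.e. $t$. The control system is assumed controllable, which means $\mathcal A\neq\emptyset$. $\iota_{\mathcal C}$ is the indicator function of a set $\mathcal C$ ($0$ on $\mathcal C$, $+\infty$ off $\mathcal C$). The functions $f,g$ on $L^2([0,1];\mathbb{R})$ are $f(u)=\frac12\int_0^1 r(t)u^2(t)\,dt+\iota_{\mathcal B}(u)$ (written $\frac r2\|\cdot\|_{L^2}^2+\iota_{\mathcal B}$ in short) and $g=\iota_{\mathcal A}$. The Fenchel conjugate of $h$ is $h^*(w)=\sup_{u\in L^2([0,1];\mathbb{R})}(\langle u,w\rangle-h(u))$. The Fenchel dual of $\min_u f(u)+g(u)$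 is $\min_w f^*(w)+g^*(-w)$. An element $w$ of $L^2$ is said to satisfy $w(t)=b^T(t)p(t)$ for all $t$ if it has this representative. *)

theory Defs
  imports "HOL-Analysis.Analysis"
begin

abbreviation unit_leb :: "real measure" where
  "unit_leb \<equiv> lebesgue_on {0..1}"

(* Elements of L^2([0,1]) are represented by square-integrable functions; functions that agree
   almost everywhere on [0,1] represent the same element.  Every functional below depends only on
   the values almost everywhere, so a supremum over representatives is one over classes. *)
definition L2 :: "(real \<Rightarrow> 'a::euclidean_space) set" where
  "L2 = {u. u \<in> borel_measurable unit_leb \<and> integrable unit_leb (\<lambda>t. (norm (u t))\<^sup>2)}"

definition L2_inner :: "(real \<Rightarrow> real) \<Rightarrow> (real \<Rightarrow> real) \<Rightarrow> real" where
  "L2_inner u w = (LINT t|unit_leb. u t * w t)"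

definition abs_continuous :: "(real \<Rightarrow> 'a::real_normed_vector) \<Rightarrow> bool" where
  "abs_continuous z \<longleftrightarrow>
    (\<forall>\<epsilon>>0. \<exists>\<delta>>0. \<forall>P :: (real \<times> real) set.
       finite P \<and> (\<forall>(s, t)\<in>P. 0 \<le> s \<and> s < t \<and> t \<le> 1) \<and>
       disjoint_family_on (\<lambda>(s, t). {s<..<t}) P \<and> (\<Sum>(s, t)\<in>P. t - s) < \<delta>
       \<longrightarrow> (\<Sum>(s, t)\<in>P. norm (z t - z s)) < \<epsilon>)"

definition W12 :: "(real \<Rightarrow> 'a::euclidean_space) set" where
  "W12 = {z. abs_continuous z \<and> z \<in> L2 \<and>
     (\<exists>v\<in>L2. AE t in unit_leb. (z has_vector_derivative v t) (at t within {0..1}))}"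

definition steering_controls ::
  "(real \<Rightarrow> real^'n^'n) \<Rightarrow> (real \<Rightarrow> real^'n) \<Rightarrow> real^'n \<Rightarrow> real^'n \<Rightarrow> (real \<Rightarrow> real) set" where
  "steering_controls A b x0 xf = {u \<in> L2. \<exists>x\<in>W12.
     (AE t in unit_leb.
        (x has_vector_derivative (A t *v x t + u t *\<^sub>R b t)) (at t within {0..1})) \<and>
     x 0 = x0 \<and> x 1 = xf}"

definition box_controls :: "(real \<Rightarrow> real) \<Rightarrow> (real \<Rightarrow> real) \<Rightarrow> (real \<Rightarrow> real) set" where
  "box_controls alo ahi = {u \<in> L2. AE t in unit_leb. alo t \<le> u t \<and> u t \<le> ahi t}"

definition set_indicator :: "(real \<Rightarrow> real) set \<Rightarrow> (real \<Rightarrow> real) \<Rightarrow> ereal" where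
  "set_indicator C u = (if u \<in> C then 0 else \<infinity>)"

definition primal_f ::
  "(real \<Rightarrow> real) \<Rightarrow> (real \<Rightarrow> real) \<Rightarrow> (real \<Rightarrow> real) \<Rightarrow> (real \<Rightarrow> real) \<Rightarrow> ereal" where
  "primal_f r alo ahi u =
     ereal (1/2 * (LINT t|unit_leb. r t * (u t)\<^sup>2)) + set_indicator (box_controls alo ahi) u"

definition primal_g ::
  "(real \<Rightarrow> real^'n^'n) \<Rightarrow> (real \<Rightarrow> real^'n) \<Rightarrow> real^'n \<Rightarrow> real^'n \<Rightarrow> (real \<Rightarrow> real) \<Rightarrow> ereal" where
  "primal_g A b x0 xf = set_indicator (steering_controls A b x0 xf)"

definition fenchel_conj :: "((real \<Rightarrow> real) \<Rightarrow> ereal) \<Rightarrow> (real \<Rightarrow> real) \<Rightarrow> ereal" where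
  "fenchel_conj h w = (SUP u\<in>L2. ereal (L2_inner u w) - h u)"

definition fenchel_dual ::
  "((real \<Rightarrow> real) \<Rightarrow> ereal) \<Rightarrow> ((real \<Rightarrow> real) \<Rightarrow> ereal) \<Rightarrow> (real \<Rightarrow> real) \<Rightarrow> ereal" where
  "fenchel_dual f g w = fenchel_conj f w + fenchel_conj g (\<lambda>t. - w t)"

definition vartheta ::
  "(real \<Rightarrow> real) \<Rightarrow> (real \<Rightarrow> real) \<Rightarrow> (real \<Rightarrow> real) \<Rightarrow> real \<Rightarrow> real \<Rightarrow> real" where
  "vartheta r alo ahi w t =
     (if w > r t * ahi t then ahi t * w - r t * (ahi t)\<^sup>2 / 2
      else if w < r t * alo t then alo t * w - r t * (alo t)\<^sup>2 / 2
      else w\<^sup>2 / (2 * r t))"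

(* The adjoint equation holds at every t (one-sided derivatives at 0 and 1), whereas w, an element
   of L^2, is only required to have t \<mapsto> b(t)^T p(t) as a representative. *)
definition dual_feasible ::
  "(real \<Rightarrow> real^'n^'n) \<Rightarrow> (real \<Rightarrow> real^'n) \<Rightarrow> (real \<Rightarrow> real) \<Rightarrow> (real \<Rightarrow> real^'n) \<Rightarrow> bool" where
  "dual_feasible A b w p \<longleftrightarrow> p \<in> W12 \<and>
     (\<forall>t\<in>{0..1}. (p has_vector_derivative - (transpose (A t) *v p t)) (at t within {0..1})) \<and>
     (AE t in unit_leb. w t = b t \<bullet> p t)"

definition dual_objective ::
  "(real \<Rightarrow> real) \<Rightarrow> (real \<Rightarrow> real) \<Rightarrow> (real \<Rightarrow> real) \<Rightarrow> real^'n \<Rightarrow> real^'n \<Rightarrow>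
   (real \<Rightarrow> real) \<Rightarrow> (real \<Rightarrow> real^'n) \<Rightarrow> real" where
  "dual_objective r alo ahi x0 xf w p =
     (LINT t|unit_leb. vartheta r alo ahi (w t) t) - (xf \<bullet> p 1 - x0 \<bullet> p 0)"

end

theory Submission
  imports Defs
begin

text \<open>The dual objective splits into the two conjugates, which are computed separately.

The conjugate of the cost \<open>f\<close> involves no dynamics.  The control may be chosen at each time
independently, so the supremum moves under the integral, where it becomes the supremum of a concave
parabola over an interval.  Its value is \<open>vartheta\<close>, attained at the projection of \<open>w / r\<close> onto the
interval (\<open>fenchel_conj_primal_f\<close>).  This conjugate is always finite.

The conjugate of \<open>g\<close> at \<open>- w\<close> is the supremum of the linear functional given by \<open>- w\<close> over the affine space
of steering controls.  If \<open>w = b \<bullet> p\<close> for an adjoint state \<open>p\<close>, then integrating the derivative of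
\<open>x \<bullet> p\<close> along any steered trajectory \<open>x\<close> shows that the functional is constant on that space, with
value \<open>- (xf \<bullet> p 1 - x0 \<bullet> p 0)\<close> (\<open>fenchel_conj_primal_g_feasible\<close>).  If there is no such \<open>p\<close>, the
functional is unbounded: otherwise it would vanish on all controls that steer \<open>0\<close> to \<open>0\<close>, and
\<open>annihilator_of_null_controls\<close> produces an adjoint state from this.  The terminal value of that adjoint
state is the vector that represents the pairing with \<open>w\<close> as a function of the end point reached from
\<open>0\<close>; finite dimension makes this function an inner product.

The analytic tools are the fundamental theorem of calculus for absolutely continuous functions, a
global existence theorem for linear differential equations, and the fundamental lemma of the
calculus of variations.\<close>

section \<open>Absolutely continuous functions and the fundamental theorem of calculus\<close>

lemma abs_continuousD:
  assumes "abs_continuous z" "\<epsilon> > 0"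
  obtains \<delta> where "\<delta> > 0"
    "\<And>P. \<lbrakk>finite P; \<And>s t. (s, t) \<in> P \<Longrightarrow> 0 \<le> s \<and> s < t \<and> t \<le> 1;
       disjoint_family_on (\<lambda>(s, t). {s<..<t}) P; (\<Sum>(s, t)\<in>P. t - s) < \<delta>\<rbrakk>
       \<Longrightarrow> (\<Sum>(s, t)\<in>P. norm (z t - z s)) < \<epsilon>"
proof -
  from assms obtain \<delta> where "\<delta> > 0" and \<delta>: "\<forall>P. finite P \<and> (\<forall>(s, t)\<in>P. 0 \<le> s \<and> s < t \<and> t \<le> 1) \<and>
       disjoint_family_on (\<lambda>(s, t). {s<..<t}) P \<and> (\<Sum>(s, t)\<in>P. t - s) < \<delta>
       \<longrightarrow> (\<Sum>(s, t)\<in>P. norm (z t - z s)) < \<epsilon>"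
    unfolding abs_continuous_def by blast
  show thesis
    by (rule that[OF \<open>\<delta> > 0\<close>]) (rule \<delta>[rule_format], auto)
qed

lemma abs_continuous_id: "abs_continuous (\<lambda>t. t)"
  unfolding abs_continuous_def
proof (intro allI impI)
  fix \<epsilon> :: real assume "\<epsilon> > 0"
  have "(\<Sum>(s, t)\<in>P. norm (t - s)) < \<epsilon>"
    if "\<forall>(s, t)\<in>P. 0 \<le> s \<and> s < t \<and> t \<le> 1" "(\<Sum>(s, t)\<in>P. t - s) < \<epsilon>" for P :: "(real \<times> real) set"
  proof -
    have "(\<Sum>(s, t)\<in>P. norm (t - s)) = (\<Sum>(s, t)\<in>P. t - s)"
      using that(1) by (intro sum.cong) auto
    then show ?thesis using that(2) by simp
  qed
  with \<open>\<epsilon> > 0\<close> show "\<exists>\<delta>>0. \<forall>P :: (real \<times> real) set.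
       finite P \<and> (\<forall>(s, t)\<in>P. 0 \<le> s \<and> s < t \<and> t \<le> 1) \<and>
       disjoint_family_on (\<lambda>(s, t). {s<..<t}) P \<and> (\<Sum>(s, t)\<in>P. t - s) < \<delta>
       \<longrightarrow> (\<Sum>(s, t)\<in>P. norm (t - s)) < \<epsilon>"
    by blast
qed

text \<open>The one way in which absolute continuity is established below: an oscillation that is controlled
by the oscillations of absolutely continuous functions is itself small over short families of
intervals.  Lipschitz functions, linear combinations and inner products are instances.\<close>

lemma abs_continuous_dominated:
  assumes x: "abs_continuous x" and y: "abs_continuous y"
    and le: "\<And>s t. \<lbrakk>s \<in> {0..1}; t \<in> {0..1}\<rbrakk>
      \<Longrightarrow> norm (z t - z s) \<le> M * (norm (x t - x s) + norm (y t - y s))"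
  shows "abs_continuous z"
  unfolding abs_continuous_def
proof (intro allI impI)
  fix \<epsilon> :: real assume "\<epsilon> > 0"
  \<comment> \<open>A positive replacement for \<open>M\<close>, so that it can be divided by.\<close>
  define C where "C = \<bar>M\<bar> + 1"
  have "C > 0" by (simp add: C_def)
  then have \<epsilon>': "\<epsilon> / (2 * C) > 0" using \<open>\<epsilon> > 0\<close> by simp
  obtain dx where dx: "dx > 0" 
    "\<And>P. \<lbrakk>finite P; \<And>s t. (s, t) \<in> P \<Longrightarrow> 0 \<le> s \<and> s < t \<and> t \<le> 1;
       disjoint_family_on (\<lambda>(s, t). {s<..<t}) P; (\<Sum>(s, t)\<in>P. t - s) < dx\<rbrakk>
       \<Longrightarrow> (\<Sum>(s, t)\<in>P. norm (x t - x s)) < \<epsilon> / (2 * C)"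
    using abs_continuousD[OF x \<epsilon>'] by blast
  obtain dy where dy: "dy > 0" 
    "\<And>P. \<lbrakk>finite P; \<And>s t. (s, t) \<in> P \<Longrightarrow> 0 \<le> s \<and> s < t \<and> t \<le> 1;
       disjoint_family_on (\<lambda>(s, t). {s<..<t}) P; (\<Sum>(s, t)\<in>P. t - s) < dy\<rbrakk>
       \<Longrightarrow> (\<Sum>(s, t)\<in>P. norm (y t - y s)) < \<epsilon> / (2 * C)"
    using abs_continuousD[OF y \<epsilon>'] by blast
  show "\<exists>\<delta>>0. \<forall>P :: (real \<times> real) set.
       finite P \<and> (\<forall>(s, t)\<in>P. 0 \<le> s \<and> s < t \<and> t \<le> 1) \<and>
       disjoint_family_on (\<lambda>(s, t). {s<..<t}) P \<and> (\<Sum>(s, t)\<in>P. t - s) < \<delta>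
       \<longrightarrow> (\<Sum>(s, t)\<in>P. norm (z t - z s)) < \<epsilon>"
  proof (intro exI[of _ "min dx dy"] conjI allI impI; (elim conjE)?)
    show "min dx dy > 0" using dx dy by simp
    fix P :: "(real \<times> real) set"
    assume P: "finite P" "\<forall>(s, t)\<in>P. 0 \<le> s \<and> s < t \<and> t \<le> 1"
      "disjoint_family_on (\<lambda>(s, t). {s<..<t}) P" "(\<Sum>(s, t)\<in>P. t - s) < min dx dy"
    have "(\<Sum>(s, t)\<in>P. norm (z t - z s)) \<le> (\<Sum>(s, t)\<in>P. C * norm (x t - x s) + C * norm (y t - y s))"
    proof (rule sum_mono, clarify)
      fix s t assume "(s, t) \<in> P"
      with P(2) have "s \<in> {0..1}" "t \<in> {0..1}" by auto
      then have "norm (z t - z s) \<le> M * (norm (x t - x s) + norm (y t - y s))" by (rule le)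
      also have "\<dots> \<le> C * (norm (x t - x s) + norm (y t - y s))"
        unfolding C_def by (intro mult_right_mono) auto
      finally show "norm (z t - z s) \<le> C * norm (x t - x s) + C * norm (y t - y s)"
        by (simp add: algebra_simps)
    qed
    also have "\<dots> = C * (\<Sum>(s, t)\<in>P. norm (x t - x s)) + C * (\<Sum>(s, t)\<in>P. norm (y t - y s))"
      by (simp add: sum.distrib case_prod_unfold sum_distrib_left)
    also have "\<dots> < C * (\<epsilon> / (2 * C)) + C * (\<epsilon> / (2 * C))"
      using \<open>C > 0\<close> P by (intro add_strict_mono mult_strict_left_mono dx(2) dy(2)) auto
    also have "\<dots> = \<epsilon>" using \<open>C > 0\<close> by (simp add: field_simps)
    finally show "(\<Sum>(s, t)\<in>P. norm (z t - z s)) < \<epsilon>" .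
  qed
qed

lemma abs_continuous_lipschitz:
  assumes "\<And>s t. \<lbrakk>s \<in> {0..1}; t \<in> {0..1}\<rbrakk> \<Longrightarrow> norm (z t - z s) \<le> M * \<bar>t - s\<bar>"
  shows "abs_continuous z"
  by (rule abs_continuous_dominated[OF abs_continuous_id abs_continuous_id, where M = "M / 2"])
    (use assms in auto)

lemma abs_continuous_imp_continuous_on:
  assumes "abs_continuous z"
  shows "continuous_on {0..1} z"
  unfolding continuous_on_iff
proof (intro ballI allI impI)
  fix t e :: real assume t: "t \<in> {0..1}" and "e > 0"
  obtain d where d: "d > 0" 
    "\<And>P. \<lbrakk>finite P; \<And>s t. (s, t) \<in> P \<Longrightarrow> 0 \<le> s \<and> s < t \<and> t \<le> 1;
       disjoint_family_on (\<lambda>(s, t). {s<..<t}) P; (\<Sum>(s, t)\<in>P. t - s) < d\<rbrakk>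
       \<Longrightarrow> (\<Sum>(s, t)\<in>P. norm (z t - z s)) < e"
    using abs_continuousD[OF assms \<open>e > 0\<close>] by blast
  have *: "dist (z b) (z a) < e" if "a < b" "0 \<le> a" "b \<le> 1" "b - a < d" for a b
    using d(2)[of "{(a, b)}"] that by (simp add: disjoint_family_on_def dist_norm)
  show "\<exists>d>0. \<forall>s\<in>{0..1}. dist s t < d \<longrightarrow> dist (z s) (z t) < e"
  proof (intro exI conjI ballI impI)
    fix s assume "s \<in> {0..1}" "dist s t < d"
    then show "dist (z s) (z t) < e"
      using *[of s t] *[of t s] t \<open>e > 0\<close>
      by (cases s t rule: linorder_cases) (auto simp: dist_commute dist_real_def)
  qed (rule d(1))
qed

text \<open>Both factors are bounded, being continuous on a compact interval, so the product rule for
differences bounds the oscillation of the inner product by those of the factors.\<close>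

lemma abs_continuous_inner:
  assumes x: "abs_continuous x" and p: "abs_continuous p"
  shows "abs_continuous (\<lambda>t. x t \<bullet> p t)"
proof -
  have "bounded (x ` {0..1})" "bounded (p ` {0..1})"
    by (intro compact_imp_bounded compact_continuous_image abs_continuous_imp_continuous_on x p
          compact_Icc)+
  then obtain Mx Mp where M: "Mx > 0" "Mp > 0"
    "\<And>t. t \<in> {0..1} \<Longrightarrow> norm (x t) \<le> Mx" "\<And>t. t \<in> {0..1} \<Longrightarrow> norm (p t) \<le> Mp"
    unfolding bounded_pos by blast
  show ?thesis
  proof (rule abs_continuous_dominated[OF x p, where M = "Mx + Mp"])
    fix s t :: real assume st: "s \<in> {0..1}" "t \<in> {0..1}"
    have "x t \<bullet> p t - x s \<bullet> p s = (x t - x s) \<bullet> p t + x s \<bullet> (p t - p s)"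
      by (simp add: inner_diff_left inner_diff_right)
    also have "norm \<dots> \<le> norm (x t - x s) * norm (p t) + norm (x s) * norm (p t - p s)"
      by (intro order_trans[OF norm_triangle_ineq] add_mono) (auto simp: Cauchy_Schwarz_ineq2)
    also have "\<dots> \<le> norm (x t - x s) * (Mx + Mp) + (Mx + Mp) * norm (p t - p s)"
      using M(3)[OF st(1)] M(4)[OF st(2)] M(1,2) by (intro add_mono mult_mono) auto
    finally show "norm (x t \<bullet> p t - x s \<bullet> p s) \<le> (Mx + Mp) * (norm (x t - x s) + norm (p t - p s))"
      by (simp add: algebra_simps)
  qed
qed

lemma AE_unit_leb_negligible:
  assumes "AE t in unit_leb. Q t"
  obtains N where "negligible N" "\<And>t. \<lbrakk>t \<in> {0..1}; t \<notin> N\<rbrakk> \<Longrightarrow> Q t"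
proof -
  have "AE t in lebesgue. t \<in> {0..1} \<longrightarrow> Q t"
    using assms by (subst (asm) AE_restrict_space_iff) auto
  then obtain N where "N \<in> null_sets lebesgue" "{t. \<not> (t \<in> {0..1} \<longrightarrow> Q t)} \<subseteq> N"
    unfolding eventually_ae_filter by auto
  then show thesis by (intro that[of N]) (auto simp: negligible_iff_null_sets)
qed

text \<open>The Henstock-Kurzweil integral gives this form of the fundamental theorem without Lebesgue's
differentiation theorem.  Where the derivative exists, the gauge is the one of the classical
fundamental theorem.  The exceptional null set \<open>N\<close>, on which the integrand may be set to zero, is
covered by an open set \<open>T\<close> of measure below the \<open>\<delta>\<close> of absolute continuity, and the gauge keeps the
intervals tagged in \<open>N\<close> inside \<open>T\<close>.  Their total length is then below \<open>\<delta>\<close>, so the increments of \<open>z\<close>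
over them have a small sum.\<close>

theorem abs_continuous_fundamental_theorem:
  fixes z :: "real \<Rightarrow> 'a::euclidean_space"
  assumes z: "abs_continuous z"
    and deriv: "AE t in unit_leb. (z has_vector_derivative v t) (at t within {0..1})"
  shows "(v has_integral (z 1 - z 0)) {0..1}"
proof -
  obtain N where N: "negligible N" and
    der: "\<And>t. \<lbrakk>t \<in> {0..1}; t \<notin> N\<rbrakk> \<Longrightarrow> (z has_vector_derivative v t) (at t within {0..1})"
    using AE_unit_leb_negligible[OF deriv] by blast
  define v' where "v' t = (if t \<in> N then 0 else v t)" for t
  have "(v' has_integral (z 1 - z 0)) (cbox 0 1)"
    unfolding has_integral_factor_content
  proof (intro allI impI)
    fix e :: real assume "e > 0"
    then have e2: "e / 2 > 0" by simp
    obtain \<delta> where \<delta>: "\<delta> > 0"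
      "\<And>P. \<lbrakk>finite P; \<And>s t. (s, t) \<in> P \<Longrightarrow> 0 \<le> s \<and> s < t \<and> t \<le> 1;
       disjoint_family_on (\<lambda>(s, t). {s<..<t}) P; (\<Sum>(s, t)\<in>P. t - s) < \<delta>\<rbrakk>
       \<Longrightarrow> (\<Sum>(s, t)\<in>P. norm (z t - z s)) < e / 2"
      using abs_continuousD[OF z e2] by blast
    obtain T where T: "open T" "N \<subseteq> T" "T - N \<in> lmeasurable" "emeasure lebesgue (T - N) < ennreal \<delta>"
      using sets_lebesgue_outer_open[of N \<delta>] N \<delta>(1)
      by (auto simp: negligible_imp_sets)
    have "N \<in> lmeasurable" and "measure lebesgue N = 0"
      using N by (auto simp: negligible_iff_measure)
    have T': "T \<in> lmeasurable" "measure lebesgue T < \<delta>"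
    proof -
      have "T = (T - N) \<union> N" using T(2) by auto
      then show "T \<in> lmeasurable" using T(3) \<open>N \<in> lmeasurable\<close> by (metis fmeasurable.Un)
      have "measure lebesgue (T - N) = measure lebesgue T"
        by (rule measure_Diff_null_set)
          (use N \<open>T \<in> lmeasurable\<close> in \<open>auto simp: negligible_iff_null_sets\<close>)
      moreover have "measure lebesgue (T - N) < \<delta>"
        using T(3,4) \<delta>(1) by (simp add: emeasure_eq_measure2 ennreal_less_iff)
      ultimately show "measure lebesgue T < \<delta>" by simp
    qed
    have "\<exists>d>0. (x \<in> N \<longrightarrow> ball x d \<subseteq> T) \<and> (x \<in> {0..1} - N \<longrightarrow>
         (\<forall>y\<in>{0..1}. norm (y-x) < d \<longrightarrow> norm (z y - z x - (y-x) *\<^sub>R v x) \<le> e / 2 * norm (y-x)))" for x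
    proof (cases "x \<in> N")
      case True
      then show ?thesis using T(1,2) by (metis Diff_iff open_contains_ball subsetD)
    next
      case False
      then show ?thesis
        using der[of x, unfolded has_vector_derivative_def has_derivative_within_alt] e2
        by (cases "x \<in> {0..1}") (blast intro: zero_less_one)+
    qed
    then obtain d where d: "\<And>x. 0 < d x" "\<And>x. x \<in> N \<Longrightarrow> ball x (d x) \<subseteq> T"
      "\<And>x y. \<lbrakk>x \<in> {0..1} - N; y \<in> {0..1}; norm (y-x) < d x\<rbrakk>
         \<Longrightarrow> norm (z y - z x - (y-x) *\<^sub>R v x) \<le> e / 2 * norm (y-x)"
      by metis
    show "\<exists>\<gamma>. gauge \<gamma> \<and> (\<forall>p. p tagged_division_of (cbox 0 1) \<and> \<gamma> fine p \<longrightarrow>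
      norm ((\<Sum>(x, k)\<in>p. measure lborel k *\<^sub>R v' x) - (z 1 - z 0)) \<le> e * measure lborel (cbox 0 (1::real)))"
    proof (rule exI, safe)
      show "gauge (\<lambda>x. ball x (d x))"
        using d(1) gauge_ball_dependent by blast
    next
      fix p assume ptag: "p tagged_division_of cbox 0 (1::real)" and finep: "(\<lambda>x. ball x (d x)) fine p"
      have fin: "finite p" using ptag by auto
      have sums: "1 - 0 = (\<Sum>(x,K)\<in>p. Sup K - Inf K)" "z 1 - z 0 = (\<Sum>(x,K)\<in>p. z (Sup K) - z (Inf K))"
        using additive_tagged_division_1[of 0 1 p "\<lambda>x. x"] additive_tagged_division_1[of 0 1 p z] ptag
        by (auto simp: box_real)
      have pD: "\<exists>u w. K = {u..w} \<and> u \<le> x \<and> x \<le> w \<and> 0 \<le> u \<and> w \<le> 1 \<and> Inf K = u \<and> Sup K = w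
          \<and> measure lborel K = w - u \<and> K \<subseteq> ball x (d x)" if xK: "(x, K) \<in> p" for x K
      proof -
        obtain u w where K: "K = cbox u w" using tagged_division_ofD(4)[OF ptag xK] by blast
        moreover have "x \<in> K" "K \<subseteq> cbox 0 1" using ptag xK by blast+
        moreover have "K \<subseteq> ball x (d x)" using finep xK by blast
        ultimately show ?thesis by (intro exI[of _ u] exI[of _ w]) auto
      qed
      \<comment> \<open>\<open>q\<close> collects the pieces tagged in the null set, and \<open>E\<close> is the error made on one piece.\<close>
      define q where "q = {(x,K)\<in>p. x \<in> N}"
      define E where "E = (\<lambda>(x,K). measure lborel K *\<^sub>R v' x - (z (Sup K) - z (Inf K)))"
      \<comment> \<open>Away from \<open>N\<close>, the derivative at the tag predicts the increment of \<open>z\<close> on both sides of it.\<close>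
      have "norm (\<Sum>i\<in>p - q. E i) \<le> (\<Sum>i\<in>p - q. e / 2 * (case i of (x,K) \<Rightarrow> Sup K - Inf K))"
      proof (rule sum_norm_le, safe)
        fix x K assume xK: "(x, K) \<in> p" and "(x, K) \<notin> q"
        then have xN: "x \<notin> N" by (auto simp: q_def)
        obtain u w where K: "K = {u..w}" "u \<le> x" "x \<le> w" "0 \<le> u" "w \<le> 1" "Inf K = u" "Sup K = w"
          "measure lborel K = w - u" "K \<subseteq> ball x (d x)" using pD[OF xK] by blast
        have "u \<in> K" "w \<in> K" using K(1-3) by auto
        then have uw: "norm (u - x) < d x" "norm (w - x) < d x"
          using K(9) by (auto simp: dist_real_def)
        have "norm ((w - u) *\<^sub>R v x - (z w - z u))
            = norm (z u - z x - (u - x) *\<^sub>R v x - (z w - z x - (w - x) *\<^sub>R v x))"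
          by (auto simp: algebra_simps)
        also have "\<dots> \<le> norm (z u - z x - (u - x) *\<^sub>R v x) + norm (z w - z x - (w - x) *\<^sub>R v x)"
          by (rule norm_triangle_ineq4)
        also have "\<dots> \<le> e / 2 * norm (u - x) + e / 2 * norm (w - x)"
          using K uw xN by (intro add_mono d(3)) auto
        also have "\<dots> = e / 2 * (w - u)" using K(2,3) by (simp add: field_simps)
        finally show "norm (E (x, K)) \<le> e / 2 * (Sup K - Inf K)"
          using K xN by (simp add: E_def v'_def)
      qed
      also have "\<dots> \<le> (\<Sum>i\<in>p. e / 2 * (case i of (x,K) \<Rightarrow> Sup K - Inf K))"
        using fin \<open>e > 0\<close> by (intro sum_mono2) (auto dest!: pD)
      also have "\<dots> = e / 2" unfolding sum_distrib_left[symmetric] sums(1)[symmetric] by simp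
      finally have off: "norm (\<Sum>i\<in>p - q. E i) \<le> e / 2" .
      \<comment> \<open>A division may contain degenerate intervals; they contribute nothing and are dropped,
        because absolute continuity speaks of proper intervals only.\<close>
      define q' where "q' = {(x,K)\<in>q. Inf K < Sup K}"
      define P where "P = (\<lambda>(x,K). (Inf K, Sup K)) ` q'"
      have q'p: "q' \<subseteq> q" "q \<subseteq> p" by (auto simp: q'_def q_def)
      have "finite q" by (rule finite_subset[OF q'p(2) fin])
      moreover from this have "finite q'" by (rule finite_subset[OF q'p(1)])
      ultimately have fin': "finite q" "finite q'" by simp_all
      \<comment> \<open>Proper pieces of a division that overlap coincide.  This makes \<open>P\<close> a disjoint family and lets
        sums over \<open>q'\<close> be rewritten as sums over \<open>P\<close>.\<close>
      have same: "i = j" if ij: "i \<in> q'" "j \<in> q'" and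
         ne: "{Inf (snd i)<..<Sup (snd i)} \<inter> {Inf (snd j)<..<Sup (snd j)} \<noteq> {}" for i j
      proof (rule ccontr)
        obtain x K y L where eq: "i = (x, K)" "j = (y, L)" by (metis prod.exhaust)
        assume "i \<noteq> j"
        then have "interior K \<inter> interior L = {}"
          using ptag ij q'p eq by (meson subsetD tagged_division_ofD(5))
        moreover have xy: "(x, K) \<in> p" "(y, L) \<in> p" using ij q'p eq by blast+
        obtain u w where "K = {u..w}" "Inf K = u" "Sup K = w" using pD[OF xy(1)] by blast
        moreover obtain u' w' where "L = {u'..w'}" "Inf L = u'" "Sup L = w'" using pD[OF xy(2)] by blast
        ultimately show False using ne by (simp add: eq interior_atLeastAtMost_real)
      qed
      have inj: "inj_on (\<lambda>(x,K). (Inf K, Sup K)) q'"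
      proof (rule inj_onI)
        fix i j :: "real \<times> real set"
        assume ij: "i \<in> q'" "j \<in> q'" and eq: "(\<lambda>(x,K). (Inf K, Sup K)) i = (\<lambda>(x,K). (Inf K, Sup K)) j"
        have "Inf (snd i) < Sup (snd i)" using ij(1) by (auto simp: q'_def)
        then have "(Inf (snd i) + Sup (snd i)) / 2 \<in> {Inf (snd i)<..<Sup (snd i)}"
          by (simp add: field_simps)
        moreover have "Inf (snd i) = Inf (snd j)" "Sup (snd i) = Sup (snd j)"
          using eq by (auto simp: case_prod_unfold)
        ultimately show "i = j" by (intro same[OF ij]) (simp only: Int_absorb, blast)
      qed
      have disj: "disjoint_family_on (\<lambda>(s, t). {s<..<t}) P"
        unfolding disjoint_family_on_def
      proof (intro ballI impI)
        fix a c assume "a \<in> P" "c \<in> P" "a \<noteq> c"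
        then obtain i j where ij: "i \<in> q'" "j \<in> q'" "i \<noteq> j"
          "a = (Inf (snd i), Sup (snd i))" "c = (Inf (snd j), Sup (snd j))"
          unfolding P_def by (auto simp: case_prod_unfold)
        then show "(case a of (s, t) \<Rightarrow> {s<..<t}) \<inter> (case c of (s, t) \<Rightarrow> {s<..<t}) = {}"
          using same[OF ij(1,2)] by (simp only: case_prod_conv) blast
      qed
      have Pbd: "0 \<le> s \<and> s < t \<and> t \<le> 1" "{s<..<t} \<subseteq> T" if stP: "(s, t) \<in> P" for s t
      proof -
        obtain x K where xK: "(x, K) \<in> p" "x \<in> N" "s = Inf K" "t = Sup K" "Inf K < Sup K"
          using stP by (auto simp: P_def q'_def q_def)
        obtain u w where K: "K = {u..w}" "0 \<le> u" "w \<le> 1" "Inf K = u" "Sup K = w" "K \<subseteq> ball x (d x)"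
          using pD[OF xK(1)] by blast
        show "0 \<le> s \<and> s < t \<and> t \<le> 1" using K xK(3-5) by simp
        have "{s<..<t} \<subseteq> K" using K(1,4,5) xK(3,4) by auto
        then show "{s<..<t} \<subseteq> T" using K(6) d(2)[OF xK(2)] by blast
      qed
      have "finite P" using fin' by (simp add: P_def)
      have "(\<Sum>(s, t)\<in>P. t - s) = (\<Sum>i\<in>P. measure lebesgue (case i of (s, t) \<Rightarrow> {s<..<t}))"
        by (intro sum.cong refl) (use Pbd(1) in \<open>fastforce simp: less_imp_le\<close>)
      also have "\<dots> = measure lebesgue (\<Union>i\<in>P. case i of (s, t) \<Rightarrow> {s<..<t})"
        using \<open>finite P\<close> disj emeasure_bounded_finite[of "{_<..<_::real}"]
        by (intro measure_finite_Union[symmetric]) (auto simp: less_top)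
      also have "\<dots> \<le> measure lebesgue T"
        using Pbd(2) T'(1) \<open>finite P\<close>
        by (intro measure_mono_fmeasurable) (auto intro!: sets.finite_UN)
      finally have "(\<Sum>(s, t)\<in>P. t - s) < \<delta>" using T'(2) by simp
      with \<delta>(2)[OF \<open>finite P\<close> Pbd(1) disj] have small: "(\<Sum>(s, t)\<in>P. norm (z t - z s)) < e / 2" by blast
      have "norm (\<Sum>i\<in>q. E i) \<le> (\<Sum>(x,K)\<in>q. norm (z (Sup K) - z (Inf K)))"
        by (rule sum_norm_le) (auto simp: E_def v'_def q_def norm_minus_commute)
      also have "\<dots> = (\<Sum>(x,K)\<in>q'. norm (z (Sup K) - z (Inf K)))"
      proof (rule sum.mono_neutral_right[OF fin'(1) q'p(1)], clarify)
        fix x K assume "(x, K) \<in> q" "(x, K) \<notin> q'"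
        moreover from this have "Inf K \<le> Sup K" using pD[of x K] q'p by auto
        ultimately have "Inf K = Sup K" by (auto simp: q'_def)
        then show "norm (z (Sup K) - z (Inf K)) = 0" by simp
      qed
      also have "\<dots> = (\<Sum>(s, t)\<in>P. norm (z t - z s))"
        unfolding P_def sum.reindex[OF inj] by (simp add: case_prod_unfold)
      finally have on: "norm (\<Sum>i\<in>q. E i) \<le> e / 2" using small by simp
      have "(\<Sum>(x, k)\<in>p. measure lborel k *\<^sub>R v' x) - (z 1 - z 0) = (\<Sum>i\<in>p. E i)"
        unfolding sums E_def by (simp add: case_prod_unfold sum_subtractf)
      also have "\<dots> = (\<Sum>i\<in>p - q. E i) + (\<Sum>i\<in>q. E i)"
        using q'p(2) fin by (simp add: sum.subset_diff)
      also have "norm \<dots> \<le> e" using norm_triangle_le[of "\<Sum>i\<in>p - q. E i" "\<Sum>i\<in>q. E i" e] on off by simp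
      finally show "norm ((\<Sum>(x, k)\<in>p. measure lborel k *\<^sub>R v' x) - (z 1 - z 0)) \<le> e * measure lborel (cbox 0 (1::real))"
        by simp
    qed
  qed
  then have "(v' has_integral (z 1 - z 0)) {0..1}" by simp
  then show ?thesis
    by (rule has_integral_spike[OF N, rotated]) (simp add: v'_def)
qed

section \<open>Linear differential equations\<close>

text \<open>The Picard operator is made a contraction on the whole unit interval, at one stroke, by an
exponential weight: the unknown is \<open>\<phi> t = exp (- L * t) *\<^sub>R x t\<close>, for which the Lipschitz constant of
the operator is at most \<open>\<bar>K\<bar> / L < 1\<close>.  Banach's theorem is applied in the space of bounded
continuous functions on the real line, so functions on the interval are extended beyond its end
points as constants.\<close>

theorem picard_lindelof_unit_interval:
  fixes f :: "real \<Rightarrow> 'a \<Rightarrow> 'a::euclidean_space"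
  assumes cont: "continuous_on ({0..1} \<times> UNIV) (\<lambda>(t, y). f t y)"
    and lip: "\<And>t y y'. t \<in> {0..1} \<Longrightarrow> norm (f t y - f t y') \<le> K * norm (y - y')"
  obtains x where "x 0 = x0"
    "\<And>t. t \<in> {0..1} \<Longrightarrow> (x has_vector_derivative f t (x t)) (at t within {0..1})"
proof -
  define L where "L = \<bar>K\<bar> + 1"
  have "L > 0" by (simp add: L_def)
  \<comment> \<open>The retraction of the line onto the interval that defines the constant extension.\<close>
  define c where "c t = max 0 (min 1 t)" for t :: real
  have c01: "c t \<in> {0..1}" for t by (auto simp: c_def)
  have c_id: "c t = t" if "t \<in> {0..1}" for t using that by (auto simp: c_def)
  have c_cont: "continuous_on UNIV c" unfolding c_def by (intro continuous_intros)
  define F where "F \<phi> s = f s (exp (L * s) *\<^sub>R apply_bcontfun \<phi> s)" for \<phi> :: "real \<Rightarrow>\<^sub>C 'a" and s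
  have F_cont: "continuous_on {0..1} (F \<phi>)" for \<phi>
    unfolding F_def
    by (rule continuous_on_compose2[OF cont, where f = "\<lambda>s. (s, _ s)", simplified])
      (auto intro!: continuous_intros)
  define G where "G \<phi> t = exp (- L * t) *\<^sub>R (x0 + integral {0..t} (F \<phi>))" for \<phi> t
  have G_cont: "continuous_on {0..1} (G \<phi>)" for \<phi>
    unfolding G_def
    by (intro continuous_intros indefinite_integral_continuous_1 integrable_continuous_real F_cont)
  have G_bc: "(\<lambda>t. G \<phi> (c t)) \<in> bcontfun" for \<phi>
    unfolding bcontfun_def
  proof (intro CollectI conjI)
    show "continuous_on UNIV (\<lambda>t. G \<phi> (c t))"
      by (rule continuous_on_compose2[OF G_cont c_cont]) (use c01 in auto)
    have "bounded (G \<phi> ` {0..1})"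
      by (intro compact_imp_bounded compact_continuous_image G_cont compact_Icc)
    then show "bounded (range (\<lambda>t. G \<phi> (c t)))"
      by (rule bounded_subset) (use c01 in auto)
  qed
  define T where "T \<phi> = Bcontfun (\<lambda>t. G \<phi> (c t))" for \<phi>
  have T: "apply_bcontfun (T \<phi>) t = G \<phi> (c t)" for \<phi> t
    unfolding T_def by (simp add: Bcontfun_inverse G_bc)
  have "\<exists>!\<phi>. T \<phi> = \<phi>"
  proof (rule banach_fix_type[of "\<bar>K\<bar> / L"], safe)
    show "0 \<le> \<bar>K\<bar> / L" "\<bar>K\<bar> / L < 1" by (auto simp: L_def)
    fix \<phi> \<psi> :: "real \<Rightarrow>\<^sub>C 'a"
    show "dist (T \<phi>) (T \<psi>) \<le> \<bar>K\<bar> / L * dist \<phi> \<psi>"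
    proof (rule dist_bound)
      fix t0 :: real
      define t where "t = c t0"
      have t: "t \<in> {0..1}" using c01 by (simp add: t_def)
      have cF: "continuous_on {0..t} (F \<phi>)" for \<phi>
        by (rule continuous_on_subset[OF F_cont]) (use t in auto)
      have e_int: "((\<lambda>s. \<bar>K\<bar> * dist \<phi> \<psi> * exp (L * s)) has_integral
          (\<bar>K\<bar> * dist \<phi> \<psi> * (exp (L * t) / L - exp (L * 0) / L))) {0..t}"
        using t \<open>L > 0\<close>
        by (intro has_integral_mult_right fundamental_theorem_of_calculus)
          (auto intro!: derivative_eq_intros simp flip: has_real_derivative_iff_has_vector_derivative)
      have "norm (integral {0..t} (\<lambda>s. F \<phi> s - F \<psi> s)) \<le> integral {0..t} (\<lambda>s. \<bar>K\<bar> * dist \<phi> \<psi> * exp (L * s))"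
      proof (rule integral_norm_bound_integral)
        fix s assume "s \<in> {0..t}"
        then have "s \<in> {0..1}" using t by auto
        then have "norm (F \<phi> s - F \<psi> s) \<le> K * norm (exp (L * s) *\<^sub>R apply_bcontfun \<phi> s - exp (L * s) *\<^sub>R apply_bcontfun \<psi> s)"
          unfolding F_def by (rule lip)
        also have "\<dots> \<le> \<bar>K\<bar> * (exp (L * s) * dist (apply_bcontfun \<phi> s) (apply_bcontfun \<psi> s))"
          by (intro mult_mono) (auto simp: dist_norm simp flip: scaleR_diff_right)
        also have "\<dots> \<le> \<bar>K\<bar> * (exp (L * s) * dist \<phi> \<psi>)"
          by (intro mult_left_mono dist_bounded) auto
        finally show "norm (F \<phi> s - F \<psi> s) \<le> \<bar>K\<bar> * dist \<phi> \<psi> * exp (L * s)" by (simp add: ac_simps)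
      next
        show "(\<lambda>s. F \<phi> s - F \<psi> s) integrable_on {0..t}"
          by (intro integrable_diff integrable_continuous_real cF)
        show "(\<lambda>s. \<bar>K\<bar> * dist \<phi> \<psi> * exp (L * s)) integrable_on {0..t}"
          using e_int by blast
      qed
      also have "\<dots> = \<bar>K\<bar> * dist \<phi> \<psi> * (exp (L * t) / L - exp (L * 0) / L)"
        using e_int by (rule integral_unique)
      also have "\<dots> \<le> \<bar>K\<bar> * dist \<phi> \<psi> * (exp (L * t) / L)"
        using \<open>L > 0\<close> by (intro mult_left_mono) auto
      finally have "norm (integral {0..t} (\<lambda>s. F \<phi> s - F \<psi> s)) \<le> \<bar>K\<bar> * dist \<phi> \<psi> * (exp (L * t) / L)" .
      then have "exp (- L * t) * norm (integral {0..t} (\<lambda>s. F \<phi> s - F \<psi> s))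
          \<le> exp (- L * t) * (\<bar>K\<bar> * dist \<phi> \<psi> * (exp (L * t) / L))"
        by (intro mult_left_mono) auto
      also have "\<dots> = \<bar>K\<bar> / L * dist \<phi> \<psi> * (exp (- L * t) * exp (L * t))" by simp
      also have "exp (- L * t) * exp (L * t) = 1" by (simp flip: exp_add)
      finally have "exp (- L * t) * norm (integral {0..t} (\<lambda>s. F \<phi> s - F \<psi> s)) \<le> \<bar>K\<bar> / L * dist \<phi> \<psi>"
        by simp
      moreover have "G \<phi> t - G \<psi> t = exp (- L * t) *\<^sub>R integral {0..t} (\<lambda>s. F \<phi> s - F \<psi> s)"
        unfolding G_def
        by (simp add: integral_diff integrable_continuous_real cF algebra_simps)
      ultimately show "dist (apply_bcontfun (T \<phi>) t0) (apply_bcontfun (T \<psi>) t0) \<le> \<bar>K\<bar> / L * dist \<phi> \<psi>"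
        unfolding T by (simp add: dist_norm flip: t_def)
    qed
  qed
  then obtain \<phi> where \<phi>: "T \<phi> = \<phi>" by blast
  define x where "x t = x0 + integral {0..t} (F \<phi>)" for t
  have x_eq: "exp (L * t) *\<^sub>R apply_bcontfun \<phi> t = x t" if "t \<in> {0..1}" for t
  proof -
    have "apply_bcontfun \<phi> t = exp (- L * t) *\<^sub>R x t"
      using T[of \<phi> t] c_id[OF that] by (simp add: \<phi> G_def x_def)
    then show ?thesis by (simp flip: exp_add)
  qed
  show thesis
  proof (rule that)
    show "x 0 = x0" by (simp add: x_def)
    fix t :: real assume t: "t \<in> {0..1}"
    have "(x has_vector_derivative 0 + F \<phi> t) (at t within {0..1})"
      unfolding x_def by (intro derivative_intros integral_has_vector_derivative F_cont t)
    then show "(x has_vector_derivative f t (x t)) (at t within {0..1})"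
      by (simp add: F_def x_eq[OF t])
  qed
qed

lemma bounded_bilinear_mult_vec:
  "bounded_bilinear (\<lambda>(M :: real^'n^'m) (y :: real^'n). M *v y)"
  by (rule bilinear_conv_bounded_bilinear[THEN iffD1, unfolded bilinear_def],
    auto simp: linear_iff algebra_simps vec_eq_iff matrix_vector_mult_def sum.distrib sum_distrib_left)

lemmas continuous_on_mult_vec = bounded_bilinear.continuous_on[OF bounded_bilinear_mult_vec]

lemma linear_ode_exists:
  fixes A :: "real \<Rightarrow> real^'n^'n" and g :: "real \<Rightarrow> real^'n"
  assumes A: "continuous_on {0..1} A" and g: "continuous_on {0..1} g"
  obtains x where "x 0 = x0"
    "\<And>t. t \<in> {0..1} \<Longrightarrow> (x has_vector_derivative A t *v x t + g t) (at t within {0..1})"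
proof -
  have "compact (A ` {0..1})" by (intro compact_continuous_image A compact_Icc)
  then obtain K0 where K0: "\<And>t. t \<in> {0..1} \<Longrightarrow> norm (A t) \<le> K0"
    unfolding image_iff using compact_imp_bounded bounded_iff by (metis imageI)
  obtain B where B: "B > 0" "\<And>(M :: real^'n^'n) (y :: real^'n). norm (M *v y) \<le> norm M * norm y * B"
    using bounded_bilinear.pos_bounded[OF bounded_bilinear_mult_vec] by blast
  show thesis
  proof (rule picard_lindelof_unit_interval[where f = "\<lambda>t y. A t *v y + g t" and K = "K0 * B"])
    show "continuous_on ({0..1} \<times> UNIV) (\<lambda>(t, y). A t *v y + g t)"
      unfolding case_prod_unfold
      by (intro continuous_intros continuous_on_mult_vec continuous_on_compose2[OF A] continuous_on_compose2[OF g]) auto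
    show "norm ((A t *v y + g t) - (A t *v y' + g t)) \<le> K0 * B * norm (y - y')" if "t \<in> {0..1}" for t y y'
    proof -
      have "norm ((A t *v y + g t) - (A t *v y' + g t)) = norm (A t *v (y - y'))"
        by (simp add: matrix_vector_mult_diff_distrib)
      also have "\<dots> \<le> norm (A t) * norm (y - y') * B" by (rule B)
      also have "\<dots> \<le> K0 * norm (y - y') * B"
        using K0[OF that] B(1) by (intro mult_right_mono) auto
      finally show ?thesis by (simp add: ac_simps)
    qed
  qed (use that in blast)
qed

text \<open>The adjoint equation is prescribed at the final time; reversing time turns it into an initial value
problem.\<close>

lemma adjoint_ode_exists:
  fixes A :: "real \<Rightarrow> real^'n^'n"
  assumes A: "continuous_on {0..1} A"
  obtains p where "p 1 = c"
    "\<And>t. t \<in> {0..1} \<Longrightarrow> (p has_vector_derivative - (transpose (A t) *v p t)) (at t within {0..1})"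
proof -
  have tr: "continuous_on {0..1} (\<lambda>t. transpose (A (1 - t)))"
    unfolding transpose_def
    by (intro continuous_intros continuous_on_compose2[OF A]) auto
  obtain q where q: "q 0 = c"
    "\<And>t. t \<in> {0..1} \<Longrightarrow> (q has_vector_derivative transpose (A (1 - t)) *v q t + 0) (at t within {0..1})"
    using linear_ode_exists[OF tr continuous_on_const, of c 0] by metis
  show thesis
  proof (rule that[of "\<lambda>t. q (1 - t)"])
    fix t :: real assume t: "t \<in> {0..1}"
    have img: "(\<lambda>t. 1 - t) ` {0..1} = {0..1::real}" by simp
    have "((q \<circ> (\<lambda>t. 1 - t)) has_vector_derivative (-1) *\<^sub>R (transpose (A (1 - (1 - t))) *v q (1 - t)))
        (at t within {0..1})"
      by (rule vector_diff_chain_within)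
        (use q(2)[of "1 - t"] t in \<open>auto intro!: derivative_eq_intros simp: img\<close>)
    then show "((\<lambda>t. q (1 - t)) has_vector_derivative - (transpose (A t) *v q (1 - t))) (at t within {0..1})"
      by (simp add: o_def)
  qed (simp add: q(1))
qed

section \<open>Square-integrable and Sobolev functions\<close>

lemma finite_measure_unit_leb: "finite_measure unit_leb"
  by (rule finite_measure_lebesgue_on) auto

lemma continuous_on_imp_measurable_unit_leb:
  fixes f :: "real \<Rightarrow> 'a::euclidean_space"
  shows "continuous_on {0..1} f \<Longrightarrow> f \<in> borel_measurable unit_leb"
  by (intro continuous_imp_measurable_on_sets_lebesgue) auto

lemma continuous_on_unit_bounded:
  assumes "continuous_on {0..1::real} f"
  obtains B where "B > 0" "\<And>t. t \<in> {0..1} \<Longrightarrow> norm (f t) \<le> B"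
proof -
  have "bounded (f ` {0..1})"
    by (intro compact_imp_bounded compact_continuous_image assms compact_Icc)
  then show thesis unfolding bounded_pos using that by blast
qed

lemma L2_measurable: "u \<in> L2 \<Longrightarrow> u \<in> borel_measurable unit_leb"
  by (simp add: L2_def)

lemma L2_dominated:
  assumes u: "u \<in> borel_measurable unit_leb" and g: "continuous_on {0..1} g"
    and le: "\<And>t. t \<in> {0..1} \<Longrightarrow> norm (u t) \<le> g t"
  shows "u \<in> L2"
proof -
  obtain B where B: "B > 0" "\<And>t. t \<in> {0..1} \<Longrightarrow> norm (g t) \<le> B"
    using continuous_on_unit_bounded[OF g] by blast
  have "integrable unit_leb (\<lambda>t. (norm (u t))\<^sup>2)"
  proof (rule finite_measure.integrable_const_bound[OF finite_measure_unit_leb, where B = "B\<^sup>2"])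
    show "AE t in unit_leb. norm ((norm (u t))\<^sup>2) \<le> B\<^sup>2"
    proof (rule AE_I2)
      fix t assume "t \<in> space unit_leb"
      then have "norm (u t) \<le> B" using le[of t] B(2)[of t] by (simp add: space_restrict_space)
      then show "norm ((norm (u t))\<^sup>2) \<le> B\<^sup>2" by (simp add: power_mono)
    qed
  qed (use u in measurable)
  with u show ?thesis by (simp add: L2_def)
qed

lemma continuous_on_imp_L2: "continuous_on {0..1} u \<Longrightarrow> u \<in> L2"
  by (rule L2_dominated[where g = "\<lambda>t. norm (u t)"])
    (auto intro: continuous_on_imp_measurable_unit_leb continuous_intros)

lemma L2_lincomb:
  fixes u v :: "real \<Rightarrow> 'a::euclidean_space"
  assumes u: "u \<in> L2" and v: "v \<in> L2"
  shows "(\<lambda>t. u t + k *\<^sub>R v t) \<in> L2"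
proof -
  note [measurable] = L2_measurable[OF u] L2_measurable[OF v]
  have "integrable unit_leb (\<lambda>t. (norm (u t + k *\<^sub>R v t))\<^sup>2)"
  proof (rule Bochner_Integration.integrable_bound)
    show "integrable unit_leb (\<lambda>t. 2 * (norm (u t))\<^sup>2 + 2 * k\<^sup>2 * (norm (v t))\<^sup>2)"
      using u v by (auto simp: L2_def)
    show "AE t in unit_leb. norm ((norm (u t + k *\<^sub>R v t))\<^sup>2)
        \<le> norm (2 * (norm (u t))\<^sup>2 + 2 * k\<^sup>2 * (norm (v t))\<^sup>2)"
    proof (rule AE_I2)
      fix t
      have "(norm (u t + k *\<^sub>R v t))\<^sup>2 \<le> (norm (u t) + norm (k *\<^sub>R v t))\<^sup>2"
        by (intro power_mono norm_triangle_ineq) auto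
      also have "\<dots> \<le> 2 * (norm (u t))\<^sup>2 + 2 * (norm (k *\<^sub>R v t))\<^sup>2"
        using sum_squares_bound[of "norm (u t)" "norm (k *\<^sub>R v t)"] by (simp add: power2_sum)
      finally show "norm ((norm (u t + k *\<^sub>R v t))\<^sup>2)
        \<le> norm (2 * (norm (u t))\<^sup>2 + 2 * k\<^sup>2 * (norm (v t))\<^sup>2)"
        by (simp add: power_mult_distrib)
    qed
  qed measurable
  then show ?thesis by (simp add: L2_def)
qed

text \<open>The weight accommodates both the pairing of two elements of the space and the quadratic cost with
coefficient \<open>r\<close>.\<close>

lemma L2_integrable_weighted_mult:
  fixes u w c :: "real \<Rightarrow> real"
  assumes c: "continuous_on {0..1} c" and u: "u \<in> L2" and w: "w \<in> L2"
  shows "integrable unit_leb (\<lambda>t. c t * (u t * w t))"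
proof -
  obtain B where B: "B > 0" "\<And>t. t \<in> {0..1} \<Longrightarrow> norm (c t) \<le> B"
    using continuous_on_unit_bounded[OF c] by blast
  note [measurable] = L2_measurable[OF u] L2_measurable[OF w] continuous_on_imp_measurable_unit_leb[OF c]
  show ?thesis
  proof (rule Bochner_Integration.integrable_bound)
    show "integrable unit_leb (\<lambda>t. B * ((norm (u t))\<^sup>2 + (norm (w t))\<^sup>2))"
      using u w by (auto simp: L2_def)
    show "AE t in unit_leb. norm (c t * (u t * w t)) \<le> norm (B * ((norm (u t))\<^sup>2 + (norm (w t))\<^sup>2))"
    proof (rule AE_I2)
      fix t assume "t \<in> space unit_leb"
      then have "\<bar>c t\<bar> \<le> B" using B(2)[of t] by (simp add: space_restrict_space)
      moreover have "\<bar>u t\<bar> * \<bar>w t\<bar> \<le> (u t)\<^sup>2 + (w t)\<^sup>2"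
        using sum_squares_bound[of "\<bar>u t\<bar>" "\<bar>w t\<bar>"] mult_nonneg_nonneg[of "\<bar>u t\<bar>" "\<bar>w t\<bar>"]
        unfolding power2_abs by linarith
      ultimately have "\<bar>c t\<bar> * (\<bar>u t\<bar> * \<bar>w t\<bar>) \<le> B * ((u t)\<^sup>2 + (w t)\<^sup>2)"
        using B(1) by (intro mult_mono) auto
      then show "norm (c t * (u t * w t)) \<le> norm (B * ((norm (u t))\<^sup>2 + (norm (w t))\<^sup>2))"
        using B(1) by (simp add: abs_mult)
    qed
  qed measurable
qed

lemma L2_integrable_mult:
  fixes u w :: "real \<Rightarrow> real"
  assumes "u \<in> L2" "w \<in> L2"
  shows "integrable unit_leb (\<lambda>t. u t * w t)"
  using L2_integrable_weighted_mult[OF continuous_on_const[of _ 1] assms] by simp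

lemma L2_inner_lincomb:
  assumes "u \<in> L2" "v \<in> L2" "w \<in> L2"
  shows "L2_inner (\<lambda>t. u t + k * v t) w = L2_inner u w + k * L2_inner v w"
  using L2_integrable_mult[OF assms(1,3)] L2_integrable_mult[OF assms(2,3)]
  by (simp add: L2_inner_def distrib_right mult.assoc)

lemma L2_inner_minus_right: "L2_inner u (\<lambda>t. - w t) = - L2_inner u w"
  by (simp add: L2_inner_def)

lemma W12_I:
  assumes "abs_continuous z" "v \<in> L2"
    "AE t in unit_leb. (z has_vector_derivative v t) (at t within {0..1})"
  shows "z \<in> W12"
  using assms continuous_on_imp_L2[OF abs_continuous_imp_continuous_on[OF assms(1)]]
  unfolding W12_def by blast

lemma C1_imp_W12:
  fixes z :: "real \<Rightarrow> 'a::euclidean_space"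
  assumes deriv: "\<And>t. t \<in> {0..1} \<Longrightarrow> (z has_vector_derivative v t) (at t within {0..1})"
    and cont: "continuous_on {0..1} v"
  shows "z \<in> W12"
proof (rule W12_I)
  obtain B where B: "\<And>t. t \<in> {0..1} \<Longrightarrow> norm (v t) \<le> B"
    using continuous_on_unit_bounded[OF cont] by blast
  show "abs_continuous z"
  proof (rule abs_continuous_lipschitz)
    fix s t :: real assume st: "s \<in> {0..1}" "t \<in> {0..1}"
    show "norm (z t - z s) \<le> B * \<bar>t - s\<bar>"
      unfolding real_norm_def[symmetric]
    proof (rule differentiable_bound[of "{0..1}" z "\<lambda>t h. h *\<^sub>R v t"])
      show "onorm (\<lambda>h. h *\<^sub>R v t) \<le> B" if "t \<in> {0..1}" for t
        by (rule onorm_le) (use B[OF that] in \<open>auto simp: mult.commute[of B] intro!: mult_left_mono\<close>)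
    qed (use deriv st in \<open>auto simp: has_vector_derivative_def\<close>)
  qed
  show "v \<in> L2" by (rule continuous_on_imp_L2[OF cont])
  show "AE t in unit_leb. (z has_vector_derivative v t) (at t within {0..1})"
    by (rule AE_I2) (use deriv in \<open>simp add: space_restrict_space\<close>)
qed

lemma W12_lincomb:
  fixes x y :: "real \<Rightarrow> 'a::euclidean_space"
  assumes "x \<in> W12" "y \<in> W12"
  shows "(\<lambda>t. x t + k *\<^sub>R y t) \<in> W12"
proof -
  obtain v where v: "v \<in> L2" "AE t in unit_leb. (x has_vector_derivative v t) (at t within {0..1})"
    using assms(1) unfolding W12_def by blast
  obtain v' where v': "v' \<in> L2" "AE t in unit_leb. (y has_vector_derivative v' t) (at t within {0..1})"
    using assms(2) unfolding W12_def by blast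
  show ?thesis
  proof (rule W12_I)
    show "abs_continuous (\<lambda>t. x t + k *\<^sub>R y t)"
    proof (rule abs_continuous_dominated[of x y _ "1 + \<bar>k\<bar>"])
      fix s t :: real
      have "(x t + k *\<^sub>R y t) - (x s + k *\<^sub>R y s) = (x t - x s) + k *\<^sub>R (y t - y s)"
        by (simp add: algebra_simps)
      also have "norm \<dots> \<le> norm (x t - x s) + \<bar>k\<bar> * norm (y t - y s)"
        by (rule order_trans[OF norm_triangle_ineq]) simp
      also have "\<dots> \<le> (1 + \<bar>k\<bar>) * (norm (x t - x s) + norm (y t - y s))"
        by (simp add: algebra_simps)
      finally show "norm ((x t + k *\<^sub>R y t) - (x s + k *\<^sub>R y s))
          \<le> (1 + \<bar>k\<bar>) * (norm (x t - x s) + norm (y t - y s))" .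
    qed (use assms in \<open>auto simp: W12_def\<close>)
    show "(\<lambda>t. v t + k *\<^sub>R v' t) \<in> L2" by (rule L2_lincomb[OF v(1) v'(1)])
    show "AE t in unit_leb. ((\<lambda>t. x t + k *\<^sub>R y t) has_vector_derivative v t + k *\<^sub>R v' t) (at t within {0..1})"
      using v(2) v'(2) by eventually_elim (auto intro!: derivative_eq_intros)
  qed
qed

lemma abs_continuous_lebesgue_FTC:
  fixes z :: "real \<Rightarrow> real"
  assumes "abs_continuous z" "integrable unit_leb v"
    "AE t in unit_leb. (z has_vector_derivative v t) (at t within {0..1})"
  shows "(LINT t|unit_leb. v t) = z 1 - z 0"
  using abs_continuous_fundamental_theorem[OF assms(1,3)] lebesgue_integral_eq_integral[OF assms(2)]
  by (simp add: integral_unique)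

text \<open>The sign of \<open>h\<close> would be the ideal test function, as it turns the integral into the norm of \<open>h\<close>.  It is
not continuous, but a measurable function is almost everywhere a limit of continuous ones, and
these can be truncated to \<open>{-1..1}\<close>, so that dominated convergence applies.\<close>

lemma fundamental_lemma_calculus_of_variations:
  fixes h :: "real \<Rightarrow> real"
  assumes h: "integrable unit_leb h"
    and test: "\<And>v. continuous_on {0..1} v \<Longrightarrow> (LINT t|unit_leb. v t * h t) = 0"
  shows "AE t in unit_leb. h t = 0"
proof -
  note [measurable] = borel_measurable_integrable[OF h]
  have "(\<lambda>t. sgn (h t)) \<in> borel_measurable unit_leb" by measurable
  then have "(\<lambda>t. sgn (h t)) measurable_on {0..1}"
    by (simp add: measurable_on_iff_borel_measurable)
  then obtain N g where N: "negligible N" and g: "\<And>n. continuous_on UNIV (g n)"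
    and lim: "\<And>t. t \<notin> N \<Longrightarrow> (\<lambda>n. g n t) \<longlonglongrightarrow> (if t \<in> {0..1} then sgn (h t) else 0)"
    unfolding measurable_on_def by blast
  define \<phi> where "\<phi> n t = max (-1) (min 1 (g n t))" for n :: nat and t
  have \<phi>_cont: "continuous_on {0..1} (\<phi> n)" for n
    unfolding \<phi>_def by (intro continuous_intros continuous_on_subset[OF g]) auto
  note [measurable] = continuous_on_imp_measurable_unit_leb[OF \<phi>_cont]
  have "(\<lambda>n. LINT t|unit_leb. \<phi> n t * h t) \<longlonglongrightarrow> (LINT t|unit_leb. sgn (h t) * h t)"
  proof (rule integral_dominated_convergence)
    show "integrable unit_leb (\<lambda>t. \<bar>h t\<bar>)" using h by simp
    have "AE t in lebesgue. t \<notin> N"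
      using N by (intro AE_not_in) (simp add: negligible_iff_null_sets)
    then have "AE t in unit_leb. t \<notin> N"
      by (subst AE_restrict_space_iff) auto
    then show "AE t in unit_leb. (\<lambda>n. \<phi> n t * h t) \<longlonglongrightarrow> sgn (h t) * h t"
    proof (rule AE_mp, intro AE_I2 impI)
      fix t assume t: "t \<in> space unit_leb" "t \<notin> N"
      then have "(\<lambda>n. g n t) \<longlonglongrightarrow> sgn (h t)" using lim[of t] by (simp add: space_restrict_space)
      then have "(\<lambda>n. \<phi> n t) \<longlonglongrightarrow> max (-1) (min 1 (sgn (h t)))"
        unfolding \<phi>_def by (intro tendsto_intros)
      also have "max (-1) (min 1 (sgn (h t))) = sgn (h t)" by (simp add: sgn_if)
      finally show "(\<lambda>n. \<phi> n t * h t) \<longlonglongrightarrow> sgn (h t) * h t" by (intro tendsto_intros)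
    qed
    show "AE t in unit_leb. norm (\<phi> n t * h t) \<le> \<bar>h t\<bar>" for n
    proof (rule AE_I2)
      fix t
      have "\<bar>\<phi> n t\<bar> \<le> 1" by (auto simp: \<phi>_def)
      then show "norm (\<phi> n t * h t) \<le> \<bar>h t\<bar>"
        by (simp add: abs_mult mult_left_le_one_le)
    qed
  qed measurable
  moreover have "(LINT t|unit_leb. \<phi> n t * h t) = 0" for n by (rule test[OF \<phi>_cont])
  ultimately have "(LINT t|unit_leb. sgn (h t) * h t) = 0"
    by (simp add: LIMSEQ_const_iff)
  then have "(LINT t|unit_leb. \<bar>h t\<bar>) = 0" by (simp add: abs_sgn mult.commute)
  then show ?thesis
    using integral_nonneg_eq_0_iff_AE[of unit_leb "\<lambda>t. \<bar>h t\<bar>"] h by simp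
qed

section \<open>The conjugate of the cost\<close>

text \<open>The point of \<open>{alo t..ahi t}\<close> nearest to \<open>w / r t\<close>, hence the maximizer of the concave parabola
\<open>v * w - r t * v\<^sup>2 / 2\<close> over that interval.\<close>

definition box_projection ::
  "(real \<Rightarrow> real) \<Rightarrow> (real \<Rightarrow> real) \<Rightarrow> (real \<Rightarrow> real) \<Rightarrow> real \<Rightarrow> real \<Rightarrow> real" where
  "box_projection r alo ahi w t = max (alo t) (min (ahi t) (w / r t))"

lemma vartheta_eq_box_projection:
  assumes "r t > 0" "alo t < ahi t"
  shows "vartheta r alo ahi w t =
    box_projection r alo ahi w t * w - r t * (box_projection r alo ahi w t)\<^sup>2 / 2"
proof -
  consider "w > r t * ahi t" | "w < r t * alo t" | "r t * alo t \<le> w" "w \<le> r t * ahi t" by linarith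
  then show ?thesis
  proof cases
    case 1
    then have "ahi t < w / r t" using assms by (simp add: field_simps)
    then have "box_projection r alo ahi w t = ahi t" using assms by (simp add: box_projection_def)
    then show ?thesis using 1 by (simp add: vartheta_def)
  next
    case 2
    then have "w / r t < alo t" using assms by (simp add: field_simps)
    then have "box_projection r alo ahi w t = alo t" using assms by (simp add: box_projection_def)
    moreover have "\<not> w > r t * ahi t" using 2 assms by (smt (verit) mult_strict_left_mono)
    ultimately show ?thesis using 2 by (simp add: vartheta_def)
  next
    case 3
    then have "alo t \<le> w / r t" "w / r t \<le> ahi t" using assms by (simp_all add: field_simps)
    then have eq: "box_projection r alo ahi w t = w / r t" by (simp add: box_projection_def)
    show ?thesis using 3 assms unfolding eq vartheta_def by (simp add: field_simps power2_eq_square)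
  qed
qed

text \<open>With \<open>m\<close> the projection of \<open>w / r t\<close>, the gap in this inequality is
\<open>r t * (v - m)\<^sup>2 / 2 - (v - m) * (w - r t * m)\<close>, and the last product is nonpositive by the obtuse angle
property of the projection.\<close>

lemma vartheta_Young:
  assumes "r t > 0" "alo t < ahi t" "alo t \<le> v" "v \<le> ahi t"
  shows "v * w - r t * v\<^sup>2 / 2 \<le> vartheta r alo ahi w t"
proof -
  define m where "m = box_projection r alo ahi w t"
  have mw: "(v - m) * (w - r t * m) \<le> 0"
  proof -
    consider "ahi t \<le> w / r t" | "w / r t \<le> alo t" | "alo t < w / r t" "w / r t < ahi t" by linarith
    then show ?thesis
    proof cases
      case 1
      moreover from 1 have "r t * ahi t \<le> w" using assms by (simp add: field_simps)
      ultimately have "m = ahi t" "r t * ahi t \<le> w"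
        using assms by (simp_all add: m_def box_projection_def)
      then show ?thesis using assms by (simp add: mult_le_0_iff)
    next
      case 2
      moreover from 2 have "w \<le> r t * alo t" using assms by (simp add: field_simps)
      ultimately have "m = alo t" "w \<le> r t * alo t"
        by (simp_all add: m_def box_projection_def)
      then show ?thesis using assms by (simp add: mult_le_0_iff)
    next
      case 3
      then have "m = w / r t" by (simp add: m_def box_projection_def)
      then show ?thesis using assms(1) by simp
    qed
  qed
  have "vartheta r alo ahi w t - (v * w - r t * v\<^sup>2 / 2) = r t * (v - m)\<^sup>2 / 2 - (v - m) * (w - r t * m)"
    unfolding vartheta_eq_box_projection[of r t alo ahi, OF assms(1,2)] m_def[symmetric]
    by (simp add: field_simps power2_eq_square)
  moreover have "0 \<le> r t * (v - m)\<^sup>2 / 2" using assms(1) by simp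
  ultimately show ?thesis using mw by linarith
qed

text \<open>The supremum can be taken pointwise: \<open>vartheta_Young\<close> bounds the integrand for every admissible
control, and equality holds for the projection of \<open>w / r\<close>, which is itself an admissible control,
being measurable and bounded.\<close>

lemma fenchel_conj_primal_f:
  fixes r alo ahi :: "real \<Rightarrow> real"
  assumes r: "continuous_on {0..1} r" "\<And>t. t \<in> {0..1} \<Longrightarrow> r t > 0"
    and alo: "continuous_on {0..1} alo" and ahi: "continuous_on {0..1} ahi"
    and less: "\<And>t. t \<in> {0..1} \<Longrightarrow> alo t < ahi t"
    and w: "w \<in> L2"
  shows "fenchel_conj (primal_f r alo ahi) w = ereal (LINT t|unit_leb. vartheta r alo ahi (w t) t)"
proof -
  define m where "m t = box_projection r alo ahi (w t) t" for t
  note [measurable] = L2_measurable[OF w] continuous_on_imp_measurable_unit_leb[OF r(1)]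
    continuous_on_imp_measurable_unit_leb[OF alo] continuous_on_imp_measurable_unit_leb[OF ahi]
  have m_box: "alo t \<le> m t" "m t \<le> ahi t" if "t \<in> {0..1}" for t
    using less[OF that] by (auto simp: m_def box_projection_def)
  have m: "m \<in> L2"
  proof (rule L2_dominated[where g = "\<lambda>t. \<bar>alo t\<bar> + \<bar>ahi t\<bar>"])
    show "m \<in> borel_measurable unit_leb"
      unfolding m_def[abs_def] box_projection_def by measurable
    show "norm (m t) \<le> \<bar>alo t\<bar> + \<bar>ahi t\<bar>" if "t \<in> {0..1}" for t
      using m_box[OF that] by auto
  qed (intro continuous_intros alo ahi)
  have m_in: "m \<in> box_controls alo ahi"
    using m m_box by (auto simp: box_controls_def space_restrict_space intro!: AE_I2)
  have int_uw: "integrable unit_leb (\<lambda>t. u t * w t - r t * (u t)\<^sup>2 / 2)"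
    and val: "L2_inner u w - 1/2 * (LINT t|unit_leb. r t * (u t)\<^sup>2)
        = (LINT t|unit_leb. u t * w t - r t * (u t)\<^sup>2 / 2)" if "u \<in> L2" for u
    using L2_integrable_mult[OF that w] L2_integrable_weighted_mult[OF r(1) that that]
    by (auto simp: L2_inner_def power2_eq_square)
  have vt: "vartheta r alo ahi (w t) t = m t * w t - r t * (m t)\<^sup>2 / 2" if "t \<in> {0..1}" for t
    unfolding m_def using r(2)[OF that] less[OF that] by (rule vartheta_eq_box_projection)
  have vt_int: "(LINT t|unit_leb. vartheta r alo ahi (w t) t) = (LINT t|unit_leb. m t * w t - r t * (m t)\<^sup>2 / 2)"
    by (rule Bochner_Integration.integral_cong) (simp_all add: vt space_restrict_space)
  show ?thesis
    unfolding fenchel_conj_def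
  proof (rule SUP_eqI)
    fix u :: "real \<Rightarrow> real" assume u: "u \<in> L2"
    show "ereal (L2_inner u w) - primal_f r alo ahi u \<le> ereal (LINT t|unit_leb. vartheta r alo ahi (w t) t)"
    proof (cases "u \<in> box_controls alo ahi")
      case True
      then have "AE t in unit_leb. alo t \<le> u t \<and> u t \<le> ahi t" by (simp add: box_controls_def)
      then have "AE t in unit_leb. u t * w t - r t * (u t)\<^sup>2 / 2 \<le> m t * w t - r t * (m t)\<^sup>2 / 2"
      proof (rule AE_mp, intro AE_I2 impI)
        fix t assume "t \<in> space unit_leb" "alo t \<le> u t \<and> u t \<le> ahi t"
        then show "u t * w t - r t * (u t)\<^sup>2 / 2 \<le> m t * w t - r t * (m t)\<^sup>2 / 2"
          using vartheta_Young[of r t alo ahi "u t" "w t"] r(2)[of t] less[of t] vt[of t]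
          by (simp add: space_restrict_space)
      qed
      then have "(LINT t|unit_leb. u t * w t - r t * (u t)\<^sup>2 / 2)
          \<le> (LINT t|unit_leb. m t * w t - r t * (m t)\<^sup>2 / 2)"
        by (intro integral_mono_AE int_uw u m)
      then show ?thesis
        using True by (simp add: primal_f_def set_indicator_def vt_int flip: val[OF u])
    next
      case False
      then show ?thesis by (simp add: primal_f_def set_indicator_def)
    qed
  next
    fix y assume "\<And>u. u \<in> L2 \<Longrightarrow> ereal (L2_inner u w) - primal_f r alo ahi u \<le> y"
    from this[OF m] show "ereal (LINT t|unit_leb. vartheta r alo ahi (w t) t) \<le> y"
      using m_in by (simp add: primal_f_def set_indicator_def vt_int flip: val[OF m])
  qed
qed

section \<open>State and adjoint equations\<close>

text \<open>Integration by parts.  In the derivative of \<open>\<lambda>t. x t \<bullet> p t\<close> the matrix \<open>A t\<close> cancels against its transpose,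
and only the control term remains.\<close>

lemma state_adjoint_pairing:
  fixes A :: "real \<Rightarrow> real^'n^'n" and x p b :: "real \<Rightarrow> real^'n"
  assumes x: "abs_continuous x"
    and dx: "AE t in unit_leb. (x has_vector_derivative (A t *v x t + u t *\<^sub>R b t)) (at t within {0..1})"
    and p: "abs_continuous p"
    and dp: "\<And>t. t \<in> {0..1} \<Longrightarrow> (p has_vector_derivative - (transpose (A t) *v p t)) (at t within {0..1})"
    and int: "integrable unit_leb (\<lambda>t. u t * (b t \<bullet> p t))"
  shows "(LINT t|unit_leb. u t * (b t \<bullet> p t)) = x 1 \<bullet> p 1 - x 0 \<bullet> p 0"
proof (rule abs_continuous_lebesgue_FTC[OF abs_continuous_inner[OF x p] int])
  from dx show "AE t in unit_leb. ((\<lambda>t. x t \<bullet> p t) has_vector_derivative u t * (b t \<bullet> p t)) (at t within {0..1})"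
  proof (rule AE_mp, intro AE_I2 impI)
    fix t assume "t \<in> space unit_leb"
      and dxt: "(x has_vector_derivative (A t *v x t + u t *\<^sub>R b t)) (at t within {0..1})"
    then have t: "t \<in> {0..1}" by (simp add: space_restrict_space)
    have "x t \<bullet> (transpose (A t) *v p t) = (A t *v x t) \<bullet> p t"
      by (simp add: inner_commute[of "x t"] inner_commute[of "A t *v x t"] dot_lmul_matrix)
    then have "x t \<bullet> - (transpose (A t) *v p t) + (A t *v x t + u t *\<^sub>R b t) \<bullet> p t = u t * (b t \<bullet> p t)"
      by (simp add: inner_add_left)
    with bounded_bilinear.has_vector_derivative[OF bounded_bilinear_inner dxt dp[OF t]]
    show "((\<lambda>t. x t \<bullet> p t) has_vector_derivative u t * (b t \<bullet> p t)) (at t within {0..1})"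
      by simp
  qed
qed

lemma dual_feasible_inner:
  fixes A :: "real \<Rightarrow> real^'n^'n" and b :: "real \<Rightarrow> real^'n"
  assumes u: "u \<in> steering_controls A b x0 xf" and w: "w \<in> L2" and p: "dual_feasible A b w p"
    and b: "continuous_on {0..1} b"
  shows "L2_inner u w = xf \<bullet> p 1 - x0 \<bullet> p 0"
proof -
  obtain x where x: "x \<in> W12" "x 0 = x0" "x 1 = xf"
    "AE t in unit_leb. (x has_vector_derivative (A t *v x t + u t *\<^sub>R b t)) (at t within {0..1})"
    and uL: "u \<in> L2"
    using u unfolding steering_controls_def by blast
  have ac: "abs_continuous x" "abs_continuous p" using x p by (auto simp: W12_def dual_feasible_def)
  have "continuous_on {0..1} (\<lambda>t. b t \<bullet> p t)"
    by (intro continuous_intros b abs_continuous_imp_continuous_on ac)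
  then have bp: "(\<lambda>t. b t \<bullet> p t) \<in> L2" by (rule continuous_on_imp_L2)
  note [measurable] = L2_measurable[OF uL] L2_measurable[OF w] L2_measurable[OF bp]
  have "L2_inner u w = (LINT t|unit_leb. u t * (b t \<bullet> p t))"
    unfolding L2_inner_def
  proof (rule integral_cong_AE)
    have "AE t in unit_leb. w t = b t \<bullet> p t" using p by (simp add: dual_feasible_def)
    then show "AE t in unit_leb. u t * w t = u t * (b t \<bullet> p t)" by eventually_elim simp
  qed measurable
  also have "\<dots> = x 1 \<bullet> p 1 - x 0 \<bullet> p 0"
    by (rule state_adjoint_pairing[OF ac(1) x(4) ac(2) _ L2_integrable_mult[OF uL bp]])
      (use p in \<open>simp add: dual_feasible_def\<close>)
  finally show ?thesis using x by simp
qed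

text \<open>A linear relation between vectors and numbers that relates the zero vector to zero only is the
graph of a linear functional on its domain, and this functional is the inner product with some
vector.  Geometrically, the relation does not contain the vertical vector \<open>(0, 1)\<close>; the component
\<open>z\<close> of that vector orthogonal to the relation is a normal with nonzero vertical part, and
\<open>c\<close> is read off from it.\<close>

lemma single_valued_relation_eq_inner:
  fixes R :: "('a::euclidean_space \<times> real) set"
  assumes R: "subspace R" and ker: "\<And>s. (0, s) \<in> R \<Longrightarrow> s = 0"
  obtains c where "\<And>y s. (y, s) \<in> R \<Longrightarrow> s = c \<bullet> y"
proof -
  obtain a z where az: "a \<in> span R" "\<And>w. w \<in> span R \<Longrightarrow> orthogonal z w" "(0, 1) = a + z"
    using orthogonal_subspace_decomp_exists[of R "(0, 1)"] by metis
  have sR: "span R = R" using R by (simp add: span_eq_iff)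
  have "z \<noteq> 0"
    using az(1,3) ker[of 1] sR by auto
  have "snd z = (0, 1) \<bullet> z" by (simp add: inner_prod_def)
  also have "\<dots> = z \<bullet> z"
    using az(2)[OF az(1)] unfolding az(3) by (simp add: inner_add_left inner_add_right orthogonal_def inner_commute[of a z])
  finally have sz: "snd z \<noteq> 0" using \<open>z \<noteq> 0\<close> by simp
  show thesis
  proof (rule that[of "- fst z /\<^sub>R snd z"])
    fix y s assume "(y, s) \<in> R"
    then have "fst z \<bullet> y + snd z * s = 0"
      using az(2)[of "(y, s)"] sR by (simp add: orthogonal_def inner_prod_def)
    then show "s = (- fst z /\<^sub>R snd z) \<bullet> y" using sz by (simp add: field_simps add_eq_0_iff)
  qed
qed

text \<open>This is the only place where an adjoint state has to be found.  Consider the continuous controls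
\<open>v\<close>, each steering the system from \<open>0\<close> to some end point.  As \<open>w\<close> annihilates those that end at \<open>0\<close>, the
pairing of \<open>v\<close> with \<open>w\<close> depends on the end point only, and linearly: it is the inner product of the end
point with a fixed vector \<open>c\<close>.  If \<open>p\<close> solves the adjoint equation with \<open>p 1 = c\<close>, then integration by
parts shows that \<open>\<lambda>t. b t \<bullet> p t\<close> has the same pairing with every continuous \<open>v\<close>, so it equals \<open>w\<close>
almost everywhere.  Working with continuous controls makes the trajectories classical solutions.\<close>

lemma annihilator_of_null_controls:
  fixes A :: "real \<Rightarrow> real^'n^'n" and b :: "real \<Rightarrow> real^'n"
  assumes A: "continuous_on {0..1} A" and b: "continuous_on {0..1} b" and w: "w \<in> L2"
    and null: "\<And>v. v \<in> steering_controls A b 0 0 \<Longrightarrow> L2_inner v w = 0"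
  obtains p where "dual_feasible A b w p"
proof -
  define traj where "traj v x \<longleftrightarrow> x 0 = 0 \<and>
    (\<forall>t\<in>{0..1}. (x has_vector_derivative A t *v x t + v t *\<^sub>R b t) (at t within {0..1}))"
    for v and x :: "real \<Rightarrow> real^'n"
  have traj_W12: "x \<in> W12" if "continuous_on {0..1} v" "traj v x" for v x
  proof (rule C1_imp_W12)
    show "(x has_vector_derivative A t *v x t + v t *\<^sub>R b t) (at t within {0..1})" if "t \<in> {0..1}" for t
      using \<open>traj v x\<close> that by (simp add: traj_def)
    then have "continuous_on {0..1} x"
      by (intro continuous_on_vector_derivative)
    then show "continuous_on {0..1} (\<lambda>t. A t *v x t + v t *\<^sub>R b t)"
      by (intro continuous_intros continuous_on_mult_vec A b that)
  qed
  have traj_AE: "AE t in unit_leb. (x has_vector_derivative A t *v x t + v t *\<^sub>R b t) (at t within {0..1})"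
    if "traj v x" for v x
    using that by (intro AE_I2) (simp add: traj_def space_restrict_space)
  \<comment> \<open>The relation between end points and pairings; \<open>null\<close> says that it is single-valued at \<open>0\<close>.\<close>
  define R where "R = {(x 1, L2_inner v w) | v x. continuous_on {0..1} v \<and> traj v x}"
  have R_I: "(x 1, L2_inner v w) \<in> R" if "continuous_on {0..1} v" "traj v x" for v x
    using that unfolding R_def by blast
  have zero: "traj (\<lambda>t. 0) (\<lambda>t. 0)" by (simp add: traj_def)
  have lin: "(x 1 + k *\<^sub>R y 1, L2_inner v w + k * L2_inner v' w) \<in> R"
    if v: "continuous_on {0..1} v" "traj v x" and v': "continuous_on {0..1} v'" "traj v' y" for v x v' y k
  proof -
    have "traj (\<lambda>t. v t + k * v' t) (\<lambda>t. x t + k *\<^sub>R y t)"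
      using v(2) v'(2) unfolding traj_def
      by (auto intro!: derivative_eq_intros
          simp: matrix_vector_right_distrib matrix_vector_mult_scaleR algebra_simps)
    moreover have "continuous_on {0..1} (\<lambda>t. v t + k * v' t)"
      by (intro continuous_intros v v')
    ultimately have "(x 1 + k *\<^sub>R y 1, L2_inner (\<lambda>t. v t + k * v' t) w) \<in> R"
      using R_I by blast
    then show ?thesis
      by (simp add: L2_inner_lincomb[OF continuous_on_imp_L2[OF v(1)] continuous_on_imp_L2[OF v'(1)] w])
  qed
  have "subspace R"
    unfolding subspace_def
  proof (intro conjI ballI allI)
    show "0 \<in> R"
      using R_I[OF continuous_on_const zero] by (simp add: L2_inner_def zero_prod_def)
    show "a + c \<in> R" if ac: "a \<in> R" "c \<in> R" for a c
    proof -
      obtain v x where a: "a = (x 1, L2_inner v w)" "continuous_on {0..1} v" "traj v x"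
        using ac(1) unfolding R_def by blast
      obtain v' y where c: "c = (y 1, L2_inner v' w)" "continuous_on {0..1} v'" "traj v' y"
        using ac(2) unfolding R_def by blast
      show ?thesis using lin[OF a(2,3) c(2,3), of 1] by (simp add: a(1) c(1))
    qed
    show "k *\<^sub>R a \<in> R" if aR: "a \<in> R" for k a
    proof -
      obtain v x where a: "a = (x 1, L2_inner v w)" "continuous_on {0..1} v" "traj v x"
        using aR unfolding R_def by blast
      show ?thesis
        using lin[OF continuous_on_const zero a(2,3), of k] by (simp add: a(1) L2_inner_def)
    qed
  qed
  moreover have "s = 0" if s0: "(0, s) \<in> R" for s
  proof -
    obtain v x where v: "continuous_on {0..1} v" "traj v x" "x 1 = 0" "s = L2_inner v w"
      using s0 unfolding R_def by auto
    have "v \<in> steering_controls A b 0 0"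
      unfolding steering_controls_def
      using continuous_on_imp_L2[OF v(1)] traj_W12[OF v(1,2)] traj_AE[OF v(2)] v(2,3)
      by (auto simp: traj_def)
    then show "s = 0" using null v(4) by simp
  qed
  ultimately obtain c where c: "\<And>y s. (y, s) \<in> R \<Longrightarrow> s = c \<bullet> y"
    using single_valued_relation_eq_inner[of R] by blast
  obtain p where p: "p 1 = c"
    "\<And>t. t \<in> {0..1} \<Longrightarrow> (p has_vector_derivative - (transpose (A t) *v p t)) (at t within {0..1})"
    using adjoint_ode_exists[OF A] by metis
  have p_cont: "continuous_on {0..1} p" using p(2) by (rule continuous_on_vector_derivative)
  have p_W12: "p \<in> W12"
    by (rule C1_imp_W12[OF p(2)])
      (auto simp: transpose_def intro!: continuous_intros continuous_on_mult_vec p_cont A)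
  then have p_ac: "abs_continuous p" by (simp add: W12_def)
  have bp: "(\<lambda>t. b t \<bullet> p t) \<in> L2"
    by (intro continuous_on_imp_L2 continuous_intros b p_cont)
  have "AE t in unit_leb. w t - b t \<bullet> p t = 0"
  proof (rule fundamental_lemma_calculus_of_variations)
    have one: "(\<lambda>t. 1) \<in> L2" by (intro continuous_on_imp_L2 continuous_intros)
    show "integrable unit_leb (\<lambda>t. w t - b t \<bullet> p t)"
      using L2_integrable_mult[OF one w] L2_integrable_mult[OF one bp] by simp
    fix v :: "real \<Rightarrow> real" assume v: "continuous_on {0..1} v"
    have vL: "v \<in> L2" by (rule continuous_on_imp_L2[OF v])
    have "continuous_on {0..1} (\<lambda>t. v t *\<^sub>R b t)" by (intro continuous_intros v b)
    then obtain x where "traj v x"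
      unfolding traj_def using linear_ode_exists[OF A, of "\<lambda>t. v t *\<^sub>R b t" 0] by metis
    have "(LINT t|unit_leb. v t * (b t \<bullet> p t)) = x 1 \<bullet> p 1 - x 0 \<bullet> p 0"
      using traj_W12[OF v \<open>traj v x\<close>]
      by (intro state_adjoint_pairing[where A = A] traj_AE \<open>traj v x\<close> p_ac p(2) L2_integrable_mult vL bp)
        (auto simp: W12_def)
    also have "\<dots> = c \<bullet> x 1" using \<open>traj v x\<close> by (simp add: p(1) traj_def inner_commute)
    also have "\<dots> = L2_inner v w"
      using c[OF R_I[OF v \<open>traj v x\<close>]] by simp
    finally show "(LINT t|unit_leb. v t * (w t - b t \<bullet> p t)) = 0"
      using L2_integrable_mult[OF vL w] L2_integrable_mult[OF vL bp]
      by (simp add: right_diff_distrib L2_inner_def)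
  qed
  then have "AE t in unit_leb. w t = b t \<bullet> p t" by simp
  with p(2) p_W12 show thesis by (intro that[of p]) (simp add: dual_feasible_def)
qed

section \<open>The conjugate of the steering constraint\<close>

lemma steering_controls_add:
  fixes A :: "real \<Rightarrow> real^'n^'n" and b :: "real \<Rightarrow> real^'n"
  assumes u: "u \<in> steering_controls A b x0 xf" and v: "v \<in> steering_controls A b 0 0"
  shows "(\<lambda>t. u t + k * v t) \<in> steering_controls A b x0 xf"
proof -
  obtain x where x: "x \<in> W12" "x 0 = x0" "x 1 = xf"
    "AE t in unit_leb. (x has_vector_derivative (A t *v x t + u t *\<^sub>R b t)) (at t within {0..1})"
    and uL: "u \<in> L2"
    using u unfolding steering_controls_def by blast
  obtain y where y: "y \<in> W12" "y 0 = 0" "y 1 = 0"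
    "AE t in unit_leb. (y has_vector_derivative (A t *v y t + v t *\<^sub>R b t)) (at t within {0..1})"
    and vL: "v \<in> L2"
    using v unfolding steering_controls_def by blast
  have "(\<lambda>t. u t + k * v t) \<in> L2" using L2_lincomb[OF uL vL, of k] by simp
  moreover have "(\<lambda>t. x t + k *\<^sub>R y t) \<in> W12" by (rule W12_lincomb[OF x(1) y(1)])
  moreover have "AE t in unit_leb. ((\<lambda>t. x t + k *\<^sub>R y t) has_vector_derivative
      (A t *v (x t + k *\<^sub>R y t) + (u t + k * v t) *\<^sub>R b t)) (at t within {0..1})"
    using x(4) y(4)
    by eventually_elim (auto intro!: derivative_eq_intros
        simp: matrix_vector_right_distrib matrix_vector_mult_scaleR algebra_simps)
  ultimately show ?thesis
    unfolding steering_controls_def using x y by (auto intro!: bexI[of _ "\<lambda>t. x t + k *\<^sub>R y t"])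
qed

text \<open>By \<open>dual_feasible_inner\<close> the pairing with \<open>w\<close> is constant on the steering controls, so the supremum
is over a single value.\<close>

lemma fenchel_conj_primal_g_feasible:
  assumes "u0 \<in> steering_controls A b x0 xf" "w \<in> L2" "dual_feasible A b w p" "continuous_on {0..1} b"
  shows "fenchel_conj (primal_g A b x0 xf) (\<lambda>t. - w t) = ereal (- (xf \<bullet> p 1 - x0 \<bullet> p 0))"
  unfolding fenchel_conj_def
proof (rule SUP_eqI)
  fix u :: "real \<Rightarrow> real"
  show "ereal (L2_inner u (\<lambda>t. - w t)) - primal_g A b x0 xf u \<le> ereal (- (xf \<bullet> p 1 - x0 \<bullet> p 0))"
    using dual_feasible_inner[OF _ assms(2-4)]
    by (cases "u \<in> steering_controls A b x0 xf")
      (auto simp: primal_g_def set_indicator_def L2_inner_minus_right)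
next
  fix y assume "\<And>u. u \<in> L2 \<Longrightarrow> ereal (L2_inner u (\<lambda>t. - w t)) - primal_g A b x0 xf u \<le> y"
  from this[of u0] show "ereal (- (xf \<bullet> p 1 - x0 \<bullet> p 0)) \<le> y"
    using assms(1) dual_feasible_inner[OF assms]
    by (simp add: primal_g_def set_indicator_def L2_inner_minus_right steering_controls_def)
qed

text \<open>The steering controls form an affine space.  Some direction \<open>v\<close> of it has a nonzero pairing with \<open>w\<close>,
and the supremum of a nonconstant affine function over a line is infinite.\<close>

lemma fenchel_conj_primal_g_infeasible:
  fixes A :: "real \<Rightarrow> real^'n^'n" and b :: "real \<Rightarrow> real^'n"
  assumes A: "continuous_on {0..1} A" and b: "continuous_on {0..1} b"
    and u: "u \<in> steering_controls A b x0 xf" and w: "w \<in> L2"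
    and infeasible: "\<nexists>p. dual_feasible A b w p"
  shows "fenchel_conj (primal_g A b x0 xf) (\<lambda>t. - w t) = \<infinity>"
proof (rule ereal_top)
  fix B :: real
  obtain v where v: "v \<in> steering_controls A b 0 0" "L2_inner v w \<noteq> 0"
    using annihilator_of_null_controls[OF A b w] infeasible by blast
  \<comment> \<open>The step length for which the pairing of \<open>u + k v\<close> with \<open>- w\<close> is \<open>B\<close>.\<close>
  define k where "k = - (B + L2_inner u w) / L2_inner v w"
  define u' where "u' t = u t + k * v t" for t
  have L: "u \<in> L2" "v \<in> L2" using u v by (auto simp: steering_controls_def)
  have u': "u' \<in> steering_controls A b x0 xf"
    unfolding u'_def[abs_def] by (rule steering_controls_add[OF u v(1)])
  have "L2_inner u' w = - B"
    unfolding u'_def[abs_def] L2_inner_lincomb[OF L w] k_def using v(2) by simp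
  then have "ereal B = ereal (L2_inner u' (\<lambda>t. - w t)) - primal_g A b x0 xf u'"
    using u' by (simp add: L2_inner_minus_right primal_g_def set_indicator_def)
  also have "\<dots> \<le> fenchel_conj (primal_g A b x0 xf) (\<lambda>t. - w t)"
    unfolding fenchel_conj_def using u' by (intro SUP_upper) (simp add: steering_controls_def)
  finally show "ereal B \<le> fenchel_conj (primal_g A b x0 xf) (\<lambda>t. - w t)" .
qed

section \<open>The dual problem\<close>

theorem proposition2:
  fixes A :: "real \<Rightarrow> real^'n^'n" and b :: "real \<Rightarrow> real^'n"
    and r alo ahi :: "real \<Rightarrow> real" and x0 xf :: "real^'n"
  assumes "continuous_on {0..1} A"
    and "continuous_on {0..1} b" and "\<exists>t\<in>{0..1}. b t \<noteq> 0"
    and "continuous_on {0..1} r" and "\<And>t. t \<in> {0..1} \<Longrightarrow> r t > 0"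
    and "continuous_on {0..1} alo" and "continuous_on {0..1} ahi"
    and "\<And>t. t \<in> {0..1} \<Longrightarrow> alo t < ahi t"
    and "steering_controls A b x0 xf \<noteq> {}"
  shows "\<forall>w\<in>L2.
    (\<forall>p. dual_feasible A b w p \<longrightarrow>
       fenchel_dual (primal_f r alo ahi) (primal_g A b x0 xf) w
         = ereal (dual_objective r alo ahi x0 xf w p)) \<and>
    ((\<nexists>p. dual_feasible A b w p) \<longrightarrow>
       fenchel_dual (primal_f r alo ahi) (primal_g A b x0 xf) w = \<infinity>)"
proof (intro ballI conjI allI impI)
  fix w :: "real \<Rightarrow> real" assume w: "w \<in> L2"
  obtain u0 where u0: "u0 \<in> steering_controls A b x0 xf" using assms(9) by blast
  have f_conj: "fenchel_conj (primal_f r alo ahi) w = ereal (LINT t|unit_leb. vartheta r alo ahi (w t) t)"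
    by (rule fenchel_conj_primal_f[OF assms(4) _ assms(6,7) _ w]) (fact assms(5,8))+
  show "fenchel_dual (primal_f r alo ahi) (primal_g A b x0 xf) w = ereal (dual_objective r alo ahi x0 xf w p)"
    if "dual_feasible A b w p" for p
    using fenchel_conj_primal_g_feasible[OF u0 w that assms(2)]
    by (simp add: fenchel_dual_def dual_objective_def f_conj)
  show "fenchel_dual (primal_f r alo ahi) (primal_g A b x0 xf) w = \<infinity>"
    if "\<nexists>p. dual_feasible A b w p"
    using fenchel_conj_primal_g_infeasible[OF assms(1,2) u0 w that]
    by (simp add: fenchel_dual_def f_conj)
qed

end
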